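(* Let $T>0$, let $p\ge 2$ be an even integer, let $\pi=(\pi_n)_{n\ge1}$ be a sequence of partitions of $[0,T]$, and let $S\in V_p(\pi)$. Then for every $f\in C^p(\mathbb{R},\mathbb{R})$ and every $t\in[0,T]$ the limit $$\int_0^t f'(S(s))\,dS(s) := \lim_{n\to\infty}\sum_{[t_j,t_{j+1}]\in\pi_n}\sum_{k=1}^{p-1}\frac{f^{(k)}(S(t_j))}{k!}\,\bigl(S(t_{j+1}\wedge t)-S(t_j\wedge t)\bigr)^k$$ exists, and $$f(S(t))-f(S(0))=\int_0^t f'(S(s))\,dS(s)+\frac1{p!}\int_0^t f^{(p)}(S(s))\,d[S]^p(s).$$
   Context: Each partition is a finite set $\pi_n=\{t^n_0,\dots,t^n_{N(\pi_n)}\}$ with $0=t^n_0<t^n_1<\dots<t^n_{N(\pi_n)}=T$. We write $[t_j,t_{j+1}]\in\pi_n$ to indicate that $t_j<t_{j+1}$ are both in $\pi_n$ and are immediate successors ($\pi_n\cap(t_j,t_{j+1})=\emptyset$). The oscillation of $S\in C([0,T],\mathbb{R})$ along $\pi_n$ is $\operatorname{osc}(S,\pi_n):=\max_{[t_j,t_{j+1}]\in\pi_n}\max_{r,s\in[t_j,t_{j+1}]}|S(s)-S(r)|$. Definition of $V_p(\pi)$: a continuous path $S\in C([0,T],\mathbb{R})$ has a $p$-th variation along $\pi=(\pi_n)$, written $S\in V_p(\pi)$, if $\operatorname{osc}(S,\pi_n)\to0$ and the sequence of measures $\mu^n:=\sum_{[t_j,t_{j+1}]\in\pi_n}\delta(\cdot-t_j)\,|S(t_{j+1})-S(t_j)|^p$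 on $[0,T]$ converges weakly to a measure $\mu$ without atoms. In that case $[S]^p(t):=\mu([0,t])$, $t\in[0,T]$, is called the $p$-th variation of $S$ (along $\pi$). The integral against $d[S]^p$ is the Lebesgue–Stieltjes integral. *)

theory Defs
  imports "HOL-Analysis.Analysis"
begin

definition partition_of :: "real \<Rightarrow> real set \<Rightarrow> bool" where
  "partition_of T P \<longleftrightarrow> finite P \<and> P \<subseteq> {0..T} \<and> 0 \<in> P \<and> T \<in> P"

text \<open>The pairs of immediate successors in \<open>P\<close>, i.e. the pairs \<open>(u, v)\<close> with
  \<open>[u, v] \<in> P\<close> in the usual abuse of notation.\<close>

definition intervals :: "real set \<Rightarrow> (real \<times> real) set" where
  "intervals P = {(u, v). u \<in> P \<and> v \<in> P \<and> u < v \<and> P \<inter> {u<..<v} = {}}"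

definition osc :: "(real \<Rightarrow> real) \<Rightarrow> real set \<Rightarrow> real" where
  "osc S P = Max ((\<lambda>(u, v). SUP (r, s) \<in> {u..v} \<times> {u..v}. \<bar>S s - S r\<bar>) ` intervals P)"

text \<open>The measure \<open>\<Sum> \<delta>(\<cdot> - u) \<bar>S v - S u\<bar>^p\<close> over \<open>(u, v) \<in> intervals P\<close>, on the Borel sets of
  \<open>[0, T]\<close>: the weighted counting measure on the intervals pushed forward to left endpoints.\<close>

definition increment_measure ::
    "real \<Rightarrow> nat \<Rightarrow> (real \<Rightarrow> real) \<Rightarrow> real set \<Rightarrow> real measure" where
  "increment_measure T p S P =
     distr (point_measure (intervals P) (\<lambda>(u, v). ennreal (\<bar>S v - S u\<bar> ^ p)))
       (restrict_space borel {0..T}) fst"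

text \<open>Weak convergence of finite Borel measures. The library's \<open>weak_conv_m\<close> (via distribution
  functions on the real line) is meant for probability measures, hence the definition by
  bounded continuous test functions.\<close>

definition weakly_converges ::
    "(nat \<Rightarrow> 'a::topological_space measure) \<Rightarrow> 'a measure \<Rightarrow> bool" where
  "weakly_converges M N \<longleftrightarrow>
     (\<forall>g :: 'a \<Rightarrow> real. continuous_on (space N) g \<and> bounded (g ` space N) \<longrightarrow>
        (\<lambda>n. integral\<^sup>L (M n) g) \<longlonglongrightarrow> integral\<^sup>L N g)"

definition pth_variation_measure ::
    "real \<Rightarrow> nat \<Rightarrow> (nat \<Rightarrow> real set) \<Rightarrow> (real \<Rightarrow> real) \<Rightarrow> real measure \<Rightarrow> bool" where
  "pth_variation_measure T p \<pi> S \<mu> \<longleftrightarrow>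
     finite_measure \<mu> \<and>
     space \<mu> = {0..T} \<and> sets \<mu> = sets (restrict_space borel {0..T}) \<and>
     (\<forall>x\<in>{0..T}. emeasure \<mu> {x} = 0) \<and>
     weakly_converges (\<lambda>n. increment_measure T p S (\<pi> n)) \<mu>"

text \<open>Paths on \<open>[0, T]\<close> are functions on \<open>\<real>\<close> whose values outside \<open>[0, T]\<close> are irrelevant.\<close>

definition V :: "real \<Rightarrow> nat \<Rightarrow> (nat \<Rightarrow> real set) \<Rightarrow> (real \<Rightarrow> real) set" where
  "V T p \<pi> = {S. continuous_on {0..T} S \<and> (\<lambda>n. osc S (\<pi> n)) \<longlonglongrightarrow> 0 \<and>
     (\<exists>\<mu>. pth_variation_measure T p \<pi> S \<mu>)}"

text \<open>The choice is harmless: a weak limit of finite Borel measures on \<open>[0, T]\<close> is unique.\<close>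

definition pth_variation ::
    "real \<Rightarrow> nat \<Rightarrow> (nat \<Rightarrow> real set) \<Rightarrow> (real \<Rightarrow> real) \<Rightarrow> real \<Rightarrow> real" where
  "pth_variation T p \<pi> S t = measure (SOME \<mu>. pth_variation_measure T p \<pi> S \<mu>) {0..t}"

text \<open>\<open>interval_measure\<close> needs an integrator on all of \<open>\<real>\<close>, so \<open>F\<close> is extended from \<open>[0, T]\<close> by
  constants; this adds no mass outside \<open>[0, T]\<close> and none at the endpoints if \<open>F\<close> is continuous.\<close>

definition stieltjes_measure :: "real \<Rightarrow> (real \<Rightarrow> real) \<Rightarrow> real measure" where
  "stieltjes_measure T F = interval_measure (\<lambda>x. F (max 0 (min T x)))"

definition C_pow :: "nat \<Rightarrow> (real \<Rightarrow> real) set" where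
  "C_pow p = {f. (\<forall>k<p. \<forall>x. (deriv ^^ k) f field_differentiable at x) \<and>
     continuous_on UNIV ((deriv ^^ p) f)}"

definition foellmer_sum ::
    "nat \<Rightarrow> (real \<Rightarrow> real) \<Rightarrow> (real \<Rightarrow> real) \<Rightarrow> real \<Rightarrow> real set \<Rightarrow> real" where
  "foellmer_sum p f S t P =
     (\<Sum>(u, v)\<in>intervals P. \<Sum>k=1..p-1.
        (deriv ^^ k) f (S u) / fact k * (S (min v t) - S (min u t)) ^ k)"

definition foellmer_integral ::
    "nat \<Rightarrow> (nat \<Rightarrow> real set) \<Rightarrow> (real \<Rightarrow> real) \<Rightarrow> (real \<Rightarrow> real) \<Rightarrow> real \<Rightarrow> real" where
  "foellmer_integral p \<pi> f S t = lim (\<lambda>n. foellmer_sum p f S t (\<pi> n))"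

end

(*
  Add up the Taylor expansions of f between S(u /\ t) and S(v /\ t) over the consecutive pairs
  (u, v) of the partition: the left sides telescope to f(S t) - f(S 0), the terms of order
  1, ..., p-1 form the Foellmer sum, and since p is even the remainder is the sum of
  f^(p)(xi) |S v - S u|^p / p!. Replacing xi by S u costs at most the oscillation of f^(p) o S
  times the total mass of the increment measure, plus one vanishing term for the interval
  straddling t. What is left is the integral of the indicator of [0, t] times f^(p) o S against
  the increment measure, which converges because the limit measure has no atom at t.
*)
theory Submission
  imports Defs "HOL-Probability.Distribution_Functions"
begin

section \<open>Consecutive pairs of a partition, telescoping sums and oscillation\<close>

lemma finite_intervals: "finite P \<Longrightarrow> finite (intervals P)"
  by (rule finite_subset[of _ "P \<times> P"]) (auto simp: intervals_def)

text \<open>Induction step for telescoping. A new largest point separates no old pair, and it can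
  only follow the old maximum: any other left endpoint would have \<open>Max P\<close> strictly
  between.\<close>

lemma intervals_insert_greater:
  assumes "finite P" "P \<noteq> {}" "\<forall>a\<in>P. a < b"
  shows "intervals (insert b P) = insert (Max P, b) (intervals P)"
proof (intro set_eqI iffI; clarify)
  fix u v assume uv: "(u, v) \<in> intervals (insert b P)" "(u, v) \<notin> intervals P"
  have "u \<in> P"
    using uv(1) assms(3) by (force simp: intervals_def)
  moreover from this have v: "v = b"
    using uv by (auto simp: intervals_def)
  moreover have "w \<le> u" if "w \<in> P" for w
  proof (rule ccontr)
    assume "\<not> w \<le> u"
    then have "w \<in> insert b P \<inter> {u<..<v}"
      using that assms(3) v by auto
    then show False
      using uv(1) by (auto simp: intervals_def)
  qed
  ultimately show "u = Max P \<and> v = b"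
    using assms(1) by (auto intro: Max_eqI[symmetric])
next
  fix u v assume "(u, v) \<in> insert (Max P, b) (intervals P)"
  then consider "u = Max P" "v = b" | "(u, v) \<in> intervals P"
    by auto
  then show "(u, v) \<in> intervals (insert b P)"
  proof cases
    case 1
    then show ?thesis
      using assms Max_in[OF assms(1,2)] by (auto simp: intervals_def dest: Max_ge[OF assms(1)])
  next
    case 2
    then show ?thesis
      using assms(3) by (force simp: intervals_def)
  qed
qed

lemma sum_intervals_telescope:
  fixes \<phi> :: "real \<Rightarrow> 'a::ab_group_add"
  assumes "finite P" "P \<noteq> {}"
  shows "(\<Sum>(u, v)\<in>intervals P. \<phi> v - \<phi> u) = \<phi> (Max P) - \<phi> (Min P)"
  using assms
proof (induction P rule: finite_linorder_max_induct)
  case (insert b P)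
  show ?case
  proof (cases "P = {}")
    case True
    \<comment> \<open>The first inserted point is the real base case: it forms no pair, and maximum
      and minimum coincide.\<close>
    have "intervals {b} = {}"
      by (auto simp: intervals_def)
    then show ?thesis
      using True by simp
  next
    case False
    have notin: "(Max P, b) \<notin> intervals P"
      using insert.hyps by (auto simp: intervals_def)
    have "Min P < b"
      using insert.hyps False by simp
    then have "Max (insert b P) = b" "Min (insert b P) = Min P"
      using insert.hyps False by (auto intro!: Max_eqI less_imp_le)
    then show ?thesis
      using insert False finite_intervals[OF insert.hyps(1)] notin
      by (simp add: intervals_insert_greater)
  qed
qed simp

text \<open>Serves two choices of \<open>\<phi>\<close> later: the stopped path
  \<open>\<lambda>s. f (S (min s t))\<close>, and the indicator of \<open>{..t}\<close>, whose
  differences detect the interval straddling \<open>t\<close>.\<close>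

lemma sum_intervals_partition:
  fixes \<phi> :: "real \<Rightarrow> 'a::ab_group_add"
  assumes "partition_of T P"
  shows "(\<Sum>(u, v)\<in>intervals P. \<phi> v - \<phi> u) = \<phi> T - \<phi> 0"
proof -
  have "Max P = T" "Min P = 0"
    using assms by (auto simp: partition_of_def intro!: Max_eqI Min_eqI)
  then show ?thesis
    using sum_intervals_telescope[of P \<phi>] assms by (auto simp: partition_of_def)
qed

lemma intervals_partitionD:
  assumes "partition_of T P" "(u, v) \<in> intervals P"
  shows "0 \<le> u" "u < v" "v \<le> T"
  using assms by (auto simp: partition_of_def intervals_def)

lemma abs_diff_le_osc:
  assumes P: "partition_of T P" and S: "continuous_on {0..T} S"
    and uv: "(u, v) \<in> intervals P" and rs: "r \<in> {u..v}" "s \<in> {u..v}"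
  shows "\<bar>S s - S r\<bar> \<le> osc S P"
proof -
  have sub: "{u..v} \<subseteq> {0..T}"
    using intervals_partitionD[OF P uv] by auto
  \<comment> \<open>A real \<open>SUP\<close> dominates its members only for sets bounded above;
    compactness of \<open>{u..v}\<close> supplies the bound.\<close>
  have "bounded (S ` {u..v})"
    using S sub by (intro compact_imp_bounded compact_continuous_image)
      (auto intro: continuous_on_subset)
  then obtain B where B: "\<And>x. x \<in> {u..v} \<Longrightarrow> \<bar>S x\<bar> \<le> B"
    unfolding bounded_iff by (metis image_eqI real_norm_def)
  have "bdd_above ((\<lambda>(r, s). \<bar>S s - S r\<bar>) ` ({u..v} \<times> {u..v}))"
    by (rule bdd_aboveI[of _ "2 * B"]) (auto dest!: B)
  then have "\<bar>S s - S r\<bar> \<le> (SUP (r, s) \<in> {u..v} \<times> {u..v}. \<bar>S s - S r\<bar>)"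
    using rs by (intro cSUP_upper2[of _ _ "(r, s)"]) auto
  also have "\<dots> \<le> osc S P"
    unfolding osc_def using P uv
    by (intro Max_ge) (auto simp: partition_of_def finite_intervals image_iff intro!: bexI[of _ "(u, v)"])
  finally show ?thesis .
qed

section \<open>Increment measures as finite weighted sums\<close>

lemma
  assumes P: "partition_of T P"
  shows sets_increment_measure: "sets (increment_measure T p S P) = sets (restrict_space borel {0..T})"
    and finite_measure_increment_measure: "finite_measure (increment_measure T p S P)"
    and integral_increment_measure: "g \<in> borel_measurable (restrict_space borel {0..T}) \<Longrightarrow>
      integral\<^sup>L (increment_measure T p S P) g = (\<Sum>(u, v)\<in>intervals P. \<bar>S v - S u\<bar> ^ p * g u)"
proof -
  let ?M = "point_measure (intervals P) (\<lambda>(u, v). ennreal (\<bar>S v - S u\<bar> ^ p))"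
  have fin: "finite (intervals P)"
    using P by (simp add: partition_of_def finite_intervals)
  \<comment> \<open>On a point measure measurability only asks that left endpoints land in
    \<open>{0..T}\<close>.\<close>
  have fst: "fst \<in> measurable ?M (restrict_space borel {0..T})"
    using intervals_partitionD[OF P] by (auto simp: measurable_point_measure_eq1 space_restrict_space)
      (metis less_le_not_le order_trans nle_le)
  show "sets (increment_measure T p S P) = sets (restrict_space borel {0..T})"
    by (simp add: increment_measure_def)
  have M: "finite_measure ?M"
    using fin by (intro finite_measureI)
      (simp add: space_point_measure emeasure_point_measure_finite case_prod_unfold)
  show "finite_measure (increment_measure T p S P)"
    unfolding increment_measure_def by (rule finite_measure.finite_measure_distr[OF M fst])
  assume "g \<in> borel_measurable (restrict_space borel {0..T})"
  then have "integral\<^sup>L (increment_measure T p S P) g = integral\<^sup>L ?M (\<lambda>x. g (fst x))"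
    unfolding increment_measure_def by (intro integral_distr[OF fst])
  also have "?M = point_measure (intervals P) (\<lambda>x. ennreal (\<bar>S (snd x) - S (fst x)\<bar> ^ p))"
    by (simp add: case_prod_unfold)
  also have "integral\<^sup>L \<dots> (\<lambda>x. g (fst x)) = (\<Sum>(u, v)\<in>intervals P. \<bar>S v - S u\<bar> ^ p * g u)"
    using fin by (subst lebesgue_integral_point_measure_finite) (auto simp: case_prod_unfold)
  finally show "integral\<^sup>L (increment_measure T p S P) g = (\<Sum>(u, v)\<in>intervals P. \<bar>S v - S u\<bar> ^ p * g u)" .
qed

section \<open>Finite measures on the line: distribution functions and weak limits\<close>

lemma interval_measure_cdf:
  assumes "finite_borel_measure M"
  shows "interval_measure (cdf M) = M"
proof -
  interpret finite_borel_measure M by fact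
  show ?thesis
  proof (rule cdf_unique')
    show "finite_borel_measure (interval_measure (cdf M))"
      by (rule finite_borel_measure_interval_measure[OF cdf_nondecreasing cdf_is_right_cont
            cdf_lim_at_bot cdf_lim_at_top measure_nonneg])
    show "cdf (interval_measure (cdf M)) = cdf M"
      by (rule cdf_interval_measure[OF cdf_nondecreasing cdf_is_right_cont cdf_lim_at_bot])
  qed (fact assms)
qed

text \<open>Turns Stieltjes integrals against the variation function back into integrals against
  \<open>\<mu>\<close>. Both sides are measures on the whole line, so comparing distribution
  functions suffices.\<close>

lemma stieltjes_measure_eq_distr:
  assumes "finite_measure \<mu>" and sp: "space \<mu> = {0..T}"
    and sets: "sets \<mu> = sets (restrict_space borel {0..T})"
    and atom: "emeasure \<mu> {0} = 0" and "0 \<le> T"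
  shows "(\<lambda>x. x) \<in> measurable \<mu> borel"
    and "stieltjes_measure T (\<lambda>t. measure \<mu> {0..t}) = distr \<mu> borel (\<lambda>x. x)"
proof -
  interpret finite_measure \<mu> by fact
  show meas: "(\<lambda>x. x) \<in> measurable \<mu> borel"
    using sets by (subst measurable_cong_sets[OF sets refl]) (intro measurable_restrict_space1, simp)
  let ?\<nu> = "distr \<mu> borel (\<lambda>x. x)"
  have \<nu>: "finite_borel_measure ?\<nu>"
    by (simp add: finite_borel_measure_def finite_borel_measure_axioms_def finite_measure_distr meas)
  have "measure \<mu> {0..max 0 (min T x)} = cdf ?\<nu> x" for x
  proof -
    have "cdf ?\<nu> x = measure \<mu> ({..x} \<inter> {0..T})"
      by (simp add: cdf_def measure_distr[OF meas] sp)
    moreover have "{..x} \<inter> {0..T} = {0..max 0 (min T x)}" if "0 \<le> x"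
      using that \<open>0 \<le> T\<close> by auto
    \<comment> \<open>Left of 0 the clamped integrator takes the value
      \<open>measure \<mu> {0}\<close>, while the distribution function is 0; they agree because 0
      is no atom.\<close>
    moreover have "{..x} \<inter> {0..T} = {}" "{0..max 0 (min T x)} = {0}" if "x < 0"
      using that \<open>0 \<le> T\<close> by auto
    ultimately show ?thesis
      using atom by (cases "0 \<le> x") (simp_all add: measure_def)
  qed
  then show "stieltjes_measure T (\<lambda>t. measure \<mu> {0..t}) = ?\<nu>"
    by (simp add: stieltjes_measure_def interval_measure_cdf[OF \<nu>])
qed

text \<open>A portmanteau argument: the integrand may jump only at \<open>t\<close>, which carries
  no limit mass. The condition on \<open>M n\<close> is eventual because \<open>\<pi> 0\<close> is
  unconstrained in the application.\<close>

lemma weakly_converges_integral_atMost: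
  fixes g :: "real \<Rightarrow> real" and A :: "real set"
  assumes conv: "weakly_converges M N"
    and M: "\<forall>\<^sub>F n in sequentially. finite_measure (M n) \<and> sets (M n) = sets (restrict_space borel A)"
    and N: "finite_measure N" "sets N = sets (restrict_space borel A)"
    and atom: "measure N {t} = 0"
    and g: "continuous_on A g" "bounded (g ` A)"
  shows "(\<lambda>n. LINT x|M n. indicator {..t} x * g x) \<longlonglongrightarrow> (LINT x|N. indicator {..t} x * g x)"
proof (rule tendstoI)
  \<comment> \<open>\<open>h m\<close> is a continuous approximation of the indicator of \<open>{..t}\<close> whose error is dominated
    by the continuous bump \<open>k m\<close>, and \<open>k m\<close> shrinks to the null set \<open>{t}\<close>.\<close>
  define k h :: "nat \<Rightarrow> real \<Rightarrow> real"
    where "k m x = max 0 (1 - real m * \<bar>x - t\<bar>)"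
      and "h m x = max 0 (min 1 (1 - real m * (x - t)))" for m x
  have hk: "\<bar>indicator {..t} x - h m x\<bar> \<le> k m x" for m x
    by (auto simp: h_def k_def indicator_def mult_nonneg_nonpos)
  have k01: "0 \<le> k m x" "k m x \<le> 1" and h01: "0 \<le> h m x" "h m x \<le> 1" for m x
    by (auto simp: k_def h_def)
  have cont: "continuous_on A (k m)" "continuous_on A (h m)" for m
    unfolding k_def h_def by (intro continuous_intros)+
  obtain C where C: "0 \<le> C" "\<And>x. x \<in> A \<Longrightarrow> \<bar>g x\<bar> \<le> C"
    using g(2) unfolding bounded_iff by (metis abs_ge_zero image_eqI order_trans real_norm_def
        all_not_in_conv le_cases)
  have gC: "\<bar>a * g x\<bar> \<le> C" if "x \<in> A" "0 \<le> a" "a \<le> 1" for a x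
    using mult_mono[OF that(3) C(2)[OF that(1)]] that by (simp add: abs_mult)
  have space: "space L = A" if "sets L = sets (restrict_space borel A)" for L
    using sets_eq_imp_space_eq[OF that] by (simp add: space_restrict_space)
  have spN: "space N = A"
    by (rule space[OF N(2)])
  have intgb: "integrable L F" if "finite_measure L" "sets L = sets (restrict_space borel A)"
    "F \<in> borel_measurable (restrict_space borel A)" "\<And>x. x \<in> A \<Longrightarrow> \<bar>F x\<bar> \<le> b"
    for L and F :: "real \<Rightarrow> real" and b
    using that
    by (intro finite_measure.integrable_const_bound[of L F b])
      (auto simp: space intro!: AE_I2 cong: measurable_cong_sets)
  \<comment> \<open>Stated for arbitrary \<open>L\<close> because the indicator is cut off under
    both \<open>M n\<close> and \<open>N\<close>.\<close>
  have cut: "\<bar>(LINT x|L. indicator {..t} x * g x) - (LINT x|L. h m x * g x)\<bar> \<le> C * (LINT x|L. k m x)"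
    if L: "finite_measure L" "sets L = sets (restrict_space borel A)" for L m
  proof -
    note meas = borel_measurable_continuous_on_restrict[of A] g(1) cont
    have int1: "integrable L (\<lambda>x. indicator {..t} x * g x)"
      by (rule intgb[OF L, of _ C])
        (auto intro!: borel_measurable_times[OF measurable_restrict_space1 meas(1)] meas(2) gC)
    have int2: "integrable L (\<lambda>x. h m x * g x)"
      by (rule intgb[OF L, of _ C]) (auto intro!: borel_measurable_times[OF meas(1) meas(1)] meas(2,3,4) gC h01)
    have int3: "integrable L (k m)"
      by (rule intgb[OF L, of _ 1]) (auto intro!: meas simp: k01)
    have "\<bar>LINT x|L. indicator {..t} x * g x - h m x * g x\<bar> \<le> (LINT x|L. C * k m x)"
    proof (rule integral_abs_bound_integral)
      fix x assume "x \<in> space L"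
      then have "\<bar>indicator {..t} x - h m x\<bar> * \<bar>g x\<bar> \<le> k m x * C"
        using space[OF L(2)] by (intro mult_mono hk C) (auto simp: k01)
      then show "\<bar>indicator {..t} x * g x - h m x * g x\<bar> \<le> C * k m x"
        by (simp add: abs_mult[symmetric] algebra_simps)
    qed (use int1 int2 int3 in auto)
    then show ?thesis
      using int1 int2 by simp
  qed
  have "(\<lambda>m. LINT x|N. k m x) \<longlonglongrightarrow> (LINT x|N. indicator {t} x)"
  proof (rule integral_dominated_convergence[where w="\<lambda>_. 1"])
    show "k m \<in> borel_measurable N" for m
      using borel_measurable_continuous_on_restrict[OF cont(1)[of m]] N(2)
      by (simp cong: measurable_cong_sets)
    show "indicator {t} \<in> borel_measurable N"
      using N(2) by (auto intro!: measurable_restrict_space1 cong: measurable_cong_sets)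
    show "AE x in N. (\<lambda>m. k m x) \<longlonglongrightarrow> indicator {t} x"
    proof (rule AE_I2)
      fix x
      show "(\<lambda>m. k m x) \<longlonglongrightarrow> indicator {t} x"
      proof (cases "x = t")
        case True
        then show ?thesis
          by (simp add: k_def)
      next
        case False
        then obtain m0 where m0: "1 < real m0 * \<bar>x - t\<bar>"
          using ex_less_of_nat_mult[of "\<bar>x - t\<bar>" 1] by auto
        have "k m x = 0" if "m \<ge> m0" for m
        proof -
          have "real m0 * \<bar>x - t\<bar> \<le> real m * \<bar>x - t\<bar>"
            using that by (intro mult_right_mono) auto
          then show ?thesis
            using m0 by (simp add: k_def)
        qed
        then show ?thesis
          using False by (intro tendsto_eventually) (auto simp: eventually_sequentially intro: exI[of _ m0])
      qed
    qed
    show "integrable N (\<lambda>_. 1 :: real)"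
      using N(1) by (intro finite_measure.integrable_const)
  qed (use k01 in auto)
  moreover have "(LINT x|N. indicator {t} x :: real) = 0"
    \<comment> \<open>If \<open>t\<close> lies outside the space, the indicator vanishes there;
      otherwise its integral is the mass in \<open>atom\<close>.\<close>
    using atom by (cases "t \<in> space N") auto
  ultimately have lim: "(\<lambda>m. LINT x|N. k m x) \<longlonglongrightarrow> 0"
    by simp
  fix e :: real assume "0 < e"
  \<comment> \<open>Budget: \<open>e / 4\<close> for each of the two cutoffs and
    \<open>e / 4\<close> for weak convergence. \<open>C + 1\<close> avoids division by zero.
    \<open>m\<close> is fixed first, using \<open>N\<close> alone; since \<open>k m\<close> is
    continuous, weak convergence passes its bound to \<open>M n\<close>.\<close>
  then have "\<forall>\<^sub>F m in sequentially. (LINT x|N. k m x) < e / (4 * (C + 1))"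
    using C(1) by (intro order_tendstoD(2)[OF lim]) simp
  then obtain m where m: "(LINT x|N. k m x) < e / (4 * (C + 1))"
    by (auto simp: eventually_sequentially)
  have small: "C * a \<le> e / 4" if "a < e / (4 * (C + 1))" "0 \<le> a" for a
  proof -
    have "C * a \<le> (C + 1) * (e / (4 * (C + 1)))"
      using that C(1) by (intro mult_mono) auto
    also have "\<dots> = e / 4"
      using C(1) by (simp add: divide_simps)
    finally show ?thesis .
  qed
  have weak: "(\<lambda>n. LINT x|M n. F x) \<longlonglongrightarrow> (LINT x|N. F x)"
    if "continuous_on A F" "\<And>x. x \<in> A \<Longrightarrow> \<bar>F x\<bar> \<le> b" for F :: "real \<Rightarrow> real" and b
    using conv that by (auto simp: weakly_converges_def spN bounded_iff)
  have "(\<lambda>n. LINT x|M n. k m x) \<longlonglongrightarrow> (LINT x|N. k m x)"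
    by (rule weak[of _ 1]) (auto simp: k01 cont)
  then have ev1: "\<forall>\<^sub>F n in sequentially. (LINT x|M n. k m x) < e / (4 * (C + 1))"
    using m by (rule order_tendstoD(2))
  have "(\<lambda>n. LINT x|M n. h m x * g x) \<longlonglongrightarrow> (LINT x|N. h m x * g x)"
    by (rule weak[of _ C]) (use gC h01 in \<open>auto intro!: continuous_intros cont g(1)\<close>)
  then have ev2: "\<forall>\<^sub>F n in sequentially. dist (LINT x|M n. h m x * g x) (LINT x|N. h m x * g x) < e / 4"
    using \<open>0 < e\<close> by (intro tendstoD) auto
  show "\<forall>\<^sub>F n in sequentially.
      dist (LINT x|M n. indicator {..t} x * g x) (LINT x|N. indicator {..t} x * g x) < e"
    using M ev1 ev2
  proof eventually_elim
    case (elim n)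
    have "C * (LINT x|M n. k m x) \<le> e / 4" "C * (LINT x|N. k m x) \<le> e / 4"
      by (intro small elim(2) m Bochner_Integration.integral_nonneg k01)+
    then show ?case
      using cut[of "M n" m] cut[OF N, of m] elim(1,3) \<open>0 < e\<close> unfolding dist_real_def by argo
  qed
qed

section \<open>Taylor expansion along one partition\<close>

lemma C_pow_Taylor:
  assumes f: "f \<in> C_pow p" and "p \<ge> 1"
  obtains \<xi> where "\<xi> \<in> closed_segment a b"
    "f b - f a = (\<Sum>k=1..p-1. (deriv ^^ k) f a / fact k * (b - a) ^ k)
      + (deriv ^^ p) f \<xi> / fact p * (b - a) ^ p"
proof (cases "a = b")
  case True
  \<comment> \<open>\<open>Taylor\<close> needs distinct points. Here \<open>\<xi> = a\<close>
    works, as all powers of \<open>b - a\<close> have positive exponent.\<close>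
  then show ?thesis
    using \<open>p \<ge> 1\<close> by (intro that[of a]) (auto intro!: sum.neutral[symmetric])
next
  case False
  have "((deriv ^^ k) f has_real_derivative (deriv ^^ Suc k) f x) (at x)" if "k < p" for k x
    using f that by (auto simp: C_pow_def DERIV_deriv_iff_field_differentiable)
  then obtain \<xi> where \<xi>: "if b < a then b < \<xi> \<and> \<xi> < a else a < \<xi> \<and> \<xi> < b"
    "f b = (\<Sum>k<p. (deriv ^^ k) f a / fact k * (b - a) ^ k) + (deriv ^^ p) f \<xi> / fact p * (b - a) ^ p"
    using Taylor[of p "\<lambda>k. (deriv ^^ k) f" f "min a b" "max a b" a b] False \<open>p \<ge> 1\<close> by force
  \<comment> \<open>Index 0 contributes \<open>f a\<close>, which moves to the left side.\<close>
  have "{..<p} = insert 0 {1..p-1}"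
    using \<open>p \<ge> 1\<close> by auto
  with \<xi> show ?thesis
    by (intro that[of \<xi>]) (auto simp: closed_segment_eq_real_ivl split: if_splits)
qed

text \<open>The estimate for a single partition, scaled by \<open>fact p\<close>.
  \<open>\<epsilon>\<close> is a modulus of continuity of the top derivative at scale
  \<open>osc S P\<close>; its term comes from the intervals up to \<open>t\<close>, the other from
  the one straddling \<open>t\<close>.\<close>

lemma foellmer_sum_remainder:
  assumes P: "partition_of T P" and S: "continuous_on {0..T} S"
    and f: "f \<in> C_pow p" and "p \<ge> 1" "even p" and t: "t \<in> {0..T}"
    and C: "\<And>x. x \<in> S ` {0..T} \<Longrightarrow> \<bar>(deriv ^^ p) f x\<bar> \<le> C"
    and \<epsilon>: "\<epsilon> \<ge> 0" "\<And>x y. x \<in> S ` {0..T} \<Longrightarrow> y \<in> S ` {0..T} \<Longrightarrow> \<bar>x - y\<bar> \<le> osc S P \<Longrightarrow>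
      \<bar>(deriv ^^ p) f x - (deriv ^^ p) f y\<bar> \<le> \<epsilon>"
  shows "\<bar>fact p * (f (S t) - f (S 0) - foellmer_sum p f S t P)
      - (\<Sum>(u, v)\<in>intervals P. \<bar>S v - S u\<bar> ^ p * (indicator {..t} u * (deriv ^^ p) f (S u)))\<bar>
    \<le> \<epsilon> * (\<Sum>(u, v)\<in>intervals P. \<bar>S v - S u\<bar> ^ p) + 2 * C * osc S P ^ p"
proof -
  define G where "G = (deriv ^^ p) f"
  define R where "R u v = f (S (min v t)) - f (S (min u t))
    - (\<Sum>k=1..p-1. (deriv ^^ k) f (S u) / fact k * (S (min v t) - S (min u t)) ^ k)" for u v
  define w where "w u v = \<bar>S v - S u\<bar> ^ p" for u v
  define \<iota> :: "real \<Rightarrow> real" where "\<iota> = indicator {..t}"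
  have "0 \<in> {0..T}"
    using t by auto
  then have "0 \<le> C"
    using C[of "S 0"] by force
  \<comment> \<open>Keeps the intermediate points \<open>\<xi>\<close> inside the range of the path,
    where \<open>C\<close> and \<open>\<epsilon>\<close> apply.\<close>
  have seg: "closed_segment (S u) (S v) \<subseteq> S ` {0..T}" if "u \<in> {0..T}" "v \<in> {0..T}" for u v
  proof -
    have "convex (S ` {0..T})"
      using connected_continuous_image[OF S] by (simp add: is_interval_connected_1 flip: is_interval_convex_1)
    then show ?thesis
      using that by (intro closed_segment_subset) auto
  qed
  \<comment> \<open>\<open>\<iota> u - \<iota> v\<close> singles out the interval straddling \<open>t\<close>, and it telescopes.\<close>
  have R: "\<bar>fact p * R u v - w u v * (\<iota> u * G (S u))\<bar> \<le> \<epsilon> * w u v + 2 * C * osc S P ^ p * (\<iota> u - \<iota> v)"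
    if uv: "(u, v) \<in> intervals P" for u v
  proof -
    note b = intervals_partitionD[OF P uv]
    have osc: "\<bar>S s - S r\<bar> \<le> osc S P" if "r \<in> {u..v}" "s \<in> {u..v}" for r s
      by (rule abs_diff_le_osc[OF P S uv that])
    have pow: "\<bar>S s - S r\<bar> ^ p \<le> osc S P ^ p" if "r \<in> {u..v}" "s \<in> {u..v}" for r s
      using osc[OF that] by (intro power_mono) auto
    have "0 \<le> w u v"
      by (simp add: w_def)
    consider "t < u" | "u \<le> t" "t < v" | "v \<le> t"
      by linarith
    then show ?thesis
    proof cases
      case 1
      then have "R u v = 0" "\<iota> u = 0" "\<iota> v = 0"
        using b by (auto simp: R_def \<iota>_def min_def intro!: sum.neutral)
      then show ?thesis
        using \<open>0 \<le> w u v\<close> \<epsilon>(1) by simp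
    next
      case 2
      obtain \<xi> where \<xi>: "\<xi> \<in> closed_segment (S u) (S t)"
        "f (S t) - f (S u) = (\<Sum>k=1..p-1. (deriv ^^ k) f (S u) / fact k * (S t - S u) ^ k)
          + G \<xi> / fact p * (S t - S u) ^ p"
        by (rule C_pow_Taylor[OF f \<open>p \<ge> 1\<close>, folded G_def, of "S u" "S t"])
      have "R u v = G \<xi> / fact p * (S t - S u) ^ p"
        using 2 \<xi>(2) by (simp add: R_def min_def)
      then have "fact p * R u v = G \<xi> * \<bar>S t - S u\<bar> ^ p"
        using \<open>even p\<close> by (simp add: power_even_abs)
      \<comment> \<open>The remainder involves \<open>S t - S u\<close> but the weight involves
        \<open>S v - S u\<close>, so the two terms are bounded separately; hence the factor
        2.\<close>
      moreover have "\<bar>G \<xi>\<bar> \<le> C" "\<bar>G (S u)\<bar> \<le> C"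
        using \<xi>(1) seg[of u t] b 2 t C by (auto simp: G_def)
      then have "\<bar>G \<xi> * \<bar>S t - S u\<bar> ^ p\<bar> \<le> C * osc S P ^ p" "\<bar>G (S u) * w u v\<bar> \<le> C * osc S P ^ p"
        using b 2 \<open>0 \<le> C\<close> unfolding w_def
        by (auto simp: abs_mult power_abs intro!: mult_mono pow)
      moreover have "\<iota> u = 1" "\<iota> v = 0"
        using 2 by (auto simp: \<iota>_def)
      ultimately show ?thesis
        using mult_nonneg_nonneg[OF \<epsilon>(1) \<open>0 \<le> w u v\<close>] by (simp add: mult.commute)
    next
      case 3
      obtain \<xi> where \<xi>: "\<xi> \<in> closed_segment (S u) (S v)"
        "f (S v) - f (S u) = (\<Sum>k=1..p-1. (deriv ^^ k) f (S u) / fact k * (S v - S u) ^ k)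
          + G \<xi> / fact p * (S v - S u) ^ p"
        by (rule C_pow_Taylor[OF f \<open>p \<ge> 1\<close>, folded G_def, of "S u" "S v"])
      have "R u v = G \<xi> / fact p * (S v - S u) ^ p"
        using 3 b \<xi>(2) by (simp add: R_def min_def)
      then have "fact p * R u v = G \<xi> * w u v"
        using \<open>even p\<close> by (simp add: power_even_abs w_def)
      moreover have "\<bar>\<xi> - S u\<bar> \<le> osc S P"
        using \<xi>(1) osc[of u v] b by (auto simp: closed_segment_eq_real_ivl split: if_splits)
      then have "\<bar>G \<xi> - G (S u)\<bar> \<le> \<epsilon>"
        unfolding G_def using \<xi>(1) seg[of u v] b by (intro \<epsilon>(2)) auto
      then have "\<bar>G \<xi> - G (S u)\<bar> * w u v \<le> \<epsilon> * w u v"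
        using \<open>0 \<le> w u v\<close> by (rule mult_right_mono)
      then have "\<bar>G \<xi> * w u v - G (S u) * w u v\<bar> \<le> \<epsilon> * w u v"
        using \<open>0 \<le> w u v\<close> by (simp add: abs_mult flip: left_diff_distrib)
      moreover have "\<iota> u = 1" "\<iota> v = 1"
        using 3 b by (auto simp: \<iota>_def)
      ultimately show ?thesis
        by (simp add: mult.commute)
    qed
  qed
  have "(\<Sum>(u, v)\<in>intervals P. R u v)
      = (\<Sum>(u, v)\<in>intervals P. f (S (min v t)) - f (S (min u t))) - foellmer_sum p f S t P"
    by (simp add: R_def foellmer_sum_def case_prod_unfold sum_subtractf)
  also have "\<dots> = f (S t) - f (S 0) - foellmer_sum p f S t P"
    using sum_intervals_partition[OF P, of "\<lambda>s. f (S (min s t))"] t by simp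
  finally have sumR: "f (S t) - f (S 0) - foellmer_sum p f S t P = (\<Sum>(u, v)\<in>intervals P. R u v)" ..
  have "\<bar>fact p * (\<Sum>(u, v)\<in>intervals P. R u v) - (\<Sum>(u, v)\<in>intervals P. w u v * (\<iota> u * G (S u)))\<bar>
      = \<bar>\<Sum>(u, v)\<in>intervals P. fact p * R u v - w u v * (\<iota> u * G (S u))\<bar>"
    by (simp add: case_prod_unfold sum_subtractf sum_distrib_left)
  also have "\<dots> \<le> (\<Sum>(u, v)\<in>intervals P. \<bar>fact p * R u v - w u v * (\<iota> u * G (S u))\<bar>)"
    unfolding case_prod_unfold by (rule sum_abs)
  also have "\<dots> \<le> (\<Sum>(u, v)\<in>intervals P. \<epsilon> * w u v + 2 * C * osc S P ^ p * (\<iota> u - \<iota> v))"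
    using R by (intro sum_mono) auto
  also have "\<dots> = \<epsilon> * (\<Sum>(u, v)\<in>intervals P. w u v)
      + 2 * C * osc S P ^ p * - (\<Sum>(u, v)\<in>intervals P. \<iota> v - \<iota> u)"
    by (simp add: case_prod_unfold sum.distrib sum_subtractf flip: sum_distrib_left)
  also have "\<dots> = \<epsilon> * (\<Sum>(u, v)\<in>intervals P. w u v) + 2 * C * osc S P ^ p * (\<iota> 0 - \<iota> T)"
    unfolding sum_intervals_partition[OF P] by simp
  \<comment> \<open>The telescoped value is 1 for \<open>t < T\<close> and 0 for
    \<open>t = T\<close>, when no interval straddles \<open>t\<close>. Evenness of \<open>p\<close>
    makes the factor nonnegative.\<close>
  also have "\<dots> \<le> \<epsilon> * (\<Sum>(u, v)\<in>intervals P. w u v) + 2 * C * osc S P ^ p * 1"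
    using \<open>0 \<le> C\<close> \<open>even p\<close> by (intro add_left_mono mult_left_mono)
      (auto simp: \<iota>_def indicator_def zero_le_even_power)
  finally show ?thesis
    unfolding sumR by (simp add: w_def \<iota>_def G_def)
qed

section \<open>Passage to the limit along the partitions\<close>

theorem theorem1p5:
  fixes T :: real and p :: nat and \<pi> :: "nat \<Rightarrow> real set"
    and S f :: "real \<Rightarrow> real" and t :: real
  assumes "T > 0" and "p \<ge> 2" and "even p"
    and "\<And>n. n \<ge> 1 \<Longrightarrow> partition_of T (\<pi> n)"
    and "S \<in> V T p \<pi>"
    and "f \<in> C_pow p"
    and "t \<in> {0..T}"
  shows "convergent (\<lambda>n. foellmer_sum p f S t (\<pi> n)) \<and>
    f (S t) - f (S 0) = foellmer_integral p \<pi> f S t +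
      1 / fact p * (LINT s:{0..t}|stieltjes_measure T (pth_variation T p \<pi> S).
        (deriv ^^ p) f (S s))"
proof -
  \<comment> \<open>The same choice as in \<open>pth_variation\<close>, so the Stieltjes integrator
    is literally built from \<open>\<mu>\<close>.\<close>
  define \<mu> where "\<mu> = (SOME \<mu>. pth_variation_measure T p \<pi> S \<mu>)"
  define G where "G = (deriv ^^ p) f"
  define g where "g = G \<circ> S"
  define M where "M = (\<lambda>n. increment_measure T p S (\<pi> n))"
  have P: "\<forall>\<^sub>F n in sequentially. partition_of T (\<pi> n)"
    using assms(4) by (auto simp: eventually_sequentially)
  have S: "continuous_on {0..T} S" and osc: "(\<lambda>n. osc S (\<pi> n)) \<longlonglongrightarrow> 0"
    using assms(5) by (auto simp: V_def)
  have "pth_variation_measure T p \<pi> S \<mu>"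
    unfolding \<mu>_def using assms(5)[unfolded V_def] by (blast intro: someI_ex)
  then have \<mu>: "finite_measure \<mu>" "space \<mu> = {0..T}" "sets \<mu> = sets (restrict_space borel {0..T})"
    and atoms: "\<And>x. x \<in> {0..T} \<Longrightarrow> emeasure \<mu> {x} = 0" and weak: "weakly_converges M \<mu>"
    by (auto simp: pth_variation_measure_def M_def)
  have "continuous_on UNIV G"
    using assms(6) by (simp add: C_pow_def G_def)
  then have G: "continuous_on X G" for X
    by (rule continuous_on_subset) simp
  have g: "continuous_on {0..T} g"
    unfolding g_def by (intro continuous_on_compose S G)
  have comp: "compact (S ` {0..T})"
    by (rule compact_continuous_image[OF S compact_Icc])
  have "bounded (G ` S ` {0..T})"
    by (rule compact_imp_bounded[OF compact_continuous_image[OF G comp]])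
  then have bdd: "bounded (g ` {0..T})" and "\<exists>C. \<forall>x\<in>S ` {0..T}. \<bar>G x\<bar> \<le> C"
    by (auto simp: g_def image_comp bounded_iff)
  then obtain C where C: "\<And>x. x \<in> S ` {0..T} \<Longrightarrow> \<bar>G x\<bar> \<le> C"
    by blast

  \<comment> \<open>For \<open>n \<ge> 1\<close>, \<open>X n\<close> is the
    \<open>M n\<close>-integral of the cut-off integrand and \<open>W n\<close> the total mass of
    \<open>M n\<close>; \<open>I\<close> is the expected limit of \<open>X\<close>, and
    \<open>D n\<close> the scaled expansion error.\<close>
  define X where "X n = (\<Sum>(u, v)\<in>intervals (\<pi> n). \<bar>S v - S u\<bar> ^ p * (indicator {..t} u * g u))" for n
  define W where "W n = (\<Sum>(u, v)\<in>intervals (\<pi> n). \<bar>S v - S u\<bar> ^ p)" for n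
  define I where "I = (LINT x|\<mu>. indicator {..t} x * g x)"
  define D where "D n = fact p * (f (S t) - f (S 0) - foellmer_sum p f S t (\<pi> n)) - X n" for n

  have "(\<lambda>n. LINT x|M n. indicator {..t} x * g x) \<longlonglongrightarrow> I"
    unfolding I_def
  proof (rule weakly_converges_integral_atMost[OF weak _ \<mu>(1,3) _ g bdd])
    show "\<forall>\<^sub>F n in sequentially. finite_measure (M n) \<and> sets (M n) = sets (restrict_space borel {0..T})"
      using P by eventually_elim
        (simp add: M_def finite_measure_increment_measure sets_increment_measure)
    show "measure \<mu> {t} = 0"
      using atoms[OF assms(7)] by (simp add: measure_def)
  qed
  moreover have "\<forall>\<^sub>F n in sequentially. (LINT x|M n. indicator {..t} x * g x) = X n"
    using P
  proof eventually_elim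
    case (elim n)
    have "(\<lambda>x. indicator {..t} x * g x) \<in> borel_measurable (restrict_space borel {0..T})"
      by (intro borel_measurable_times measurable_restrict_space1[of "indicator {..t}"]
          borel_measurable_continuous_on_restrict g) auto
    then show ?case
      unfolding M_def X_def by (rule integral_increment_measure[OF elim])
  qed
  ultimately have X: "X \<longlonglongrightarrow> I"
    by (rule Lim_transform_eventually)

  \<comment> \<open>Testing with the constant 1 makes the total masses converge, hence gives a
    uniform bound \<open>K\<close>.\<close>
  have "(\<lambda>n. LINT x|M n. 1 :: real) \<longlonglongrightarrow> (LINT x|\<mu>. 1 :: real)"
    by (rule weak[unfolded weakly_converges_def, rule_format])
      (auto intro: bounded_subset[of "{1 :: real}"])
  moreover have "\<forall>\<^sub>F n in sequentially. (LINT x|M n. 1 :: real) = W n"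
    using P by eventually_elim (auto simp: M_def W_def integral_increment_measure simp del: lebesgue_integral_const)
  ultimately have W: "W \<longlonglongrightarrow> (LINT x|\<mu>. 1 :: real)"
    by (rule Lim_transform_eventually)
  then obtain K where K: "0 < K" "\<And>n. W n \<le> K"
    using convergent_imp_Bseq[of W] by (force simp: convergent_def Bseq_def abs_le_iff)

  have "D \<longlonglongrightarrow> 0"
  proof (rule tendstoI)
    fix e :: real assume "0 < e"
    \<comment> \<open>Chosen so that \<open>\<epsilon> * W n\<close> stays below
      \<open>e / 2\<close> uniformly in \<open>n\<close>.\<close>
    define \<epsilon> where "\<epsilon> = e / (2 * K)"
    have "\<epsilon> > 0"
      using \<open>0 < e\<close> K(1) by (simp add: \<epsilon>_def)
    obtain \<delta> where \<delta>: "\<delta> > 0"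
      "\<And>x y. x \<in> S ` {0..T} \<Longrightarrow> y \<in> S ` {0..T} \<Longrightarrow> \<bar>x - y\<bar> < \<delta> \<Longrightarrow> \<bar>G x - G y\<bar> < \<epsilon>"
      using compact_uniformly_continuous[OF G comp] \<open>\<epsilon> > 0\<close>
      unfolding uniformly_continuous_on_def dist_real_def by (metis abs_minus_commute)
    have "(\<lambda>n. 2 * C * osc S (\<pi> n) ^ p) \<longlonglongrightarrow> 2 * C * 0 ^ p"
      by (intro tendsto_intros osc)
    then have ev1: "\<forall>\<^sub>F n in sequentially. 2 * C * osc S (\<pi> n) ^ p < e / 2"
      using assms(2) \<open>0 < e\<close> by (intro order_tendstoD) (auto simp: zero_power)
    have ev2: "\<forall>\<^sub>F n in sequentially. osc S (\<pi> n) < \<delta>"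
      using osc \<delta>(1) by (rule order_tendstoD)
    show "\<forall>\<^sub>F n in sequentially. dist (D n) 0 < e"
      using P ev1 ev2
    proof eventually_elim
      case (elim n)
      have "\<bar>D n\<bar> \<le> \<epsilon> * W n + 2 * C * osc S (\<pi> n) ^ p"
        unfolding D_def X_def W_def g_def G_def comp_def
        by (rule foellmer_sum_remainder[OF elim(1) S assms(6) _ assms(3,7)])
          (use assms(2) C \<delta>(2) elim(3) \<open>\<epsilon> > 0\<close> in \<open>force simp: G_def\<close>)+
      moreover have "\<epsilon> * W n \<le> e / 2"
        using mult_left_mono[OF K(2)[of n], of \<epsilon>] \<open>\<epsilon> > 0\<close> K(1) by (simp add: \<epsilon>_def)
      ultimately show ?case
        using elim(2) by simp
    qed
  qed
  \<comment> \<open>The definition of \<open>D n\<close> solved for the Foellmer sum, which gives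
    existence and value of its limit together.\<close>
  then have "(\<lambda>n. f (S t) - f (S 0) - 1 / fact p * (D n + X n))
      \<longlonglongrightarrow> f (S t) - f (S 0) - 1 / fact p * (0 + I)"
    by (intro tendsto_intros X)
  then have lim: "(\<lambda>n. foellmer_sum p f S t (\<pi> n)) \<longlonglongrightarrow> f (S t) - f (S 0) - 1 / fact p * I"
    by (simp add: D_def)

  have "0 \<le> T"
    using assms(1) by simp
  have "emeasure \<mu> {0} = 0"
    using assms(1) by (intro atoms) simp
  note distr = stieltjes_measure_eq_distr[OF \<mu> this \<open>0 \<le> T\<close>]
  have st: "stieltjes_measure T (pth_variation T p \<pi> S) = distr \<mu> borel (\<lambda>x. x)"
    using distr(2) by (simp add: pth_variation_def[abs_def] \<mu>_def)
  \<comment> \<open>\<open>S\<close> is arbitrary outside \<open>{0..T}\<close>, so Borel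
    measurability on the line is shown for \<open>g\<close> times the indicator of
    \<open>{0..t}\<close>.\<close>
  have "continuous_on {0..t} g"
    using g assms(7) by (auto intro: continuous_on_subset)
  then have "(\<lambda>x. indicator {0..t} x *\<^sub>R g x) \<in> borel_measurable borel"
    by (intro borel_measurable_continuous_on_indicator) auto
  then have "(LINT s:{0..t}|stieltjes_measure T (pth_variation T p \<pi> S). g s)
      = (LINT x|\<mu>. indicator {0..t} x *\<^sub>R g x)"
    unfolding set_lebesgue_integral_def st by (rule integral_distr[OF distr(1)])
  also have "\<dots> = I"
    \<comment> \<open>On the space \<open>{0..T}\<close> the indicators of \<open>{0..t}\<close> and
      \<open>{..t}\<close> coincide.\<close>
    unfolding I_def by (intro Bochner_Integration.integral_cong refl) (auto simp: \<mu>(2) indicator_def)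
  finally have "(LINT s:{0..t}|stieltjes_measure T (pth_variation T p \<pi> S). (deriv ^^ p) f (S s)) = I"
    by (simp add: g_def G_def)
  then show ?thesis
    using lim limI[OF lim] by (auto simp: convergent_def foellmer_integral_def)
qed

end
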